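(* Let $r_k(n)$ be as in the context and let $E_n=\frac{\sum_k k\, r_k(n)}{\sum_k r_k(n)}$ be the expected number of pieces in a uniformly random division of the $2\times n$ strip. Then, as $n\to\infty$, $$E_n \sim \left(\frac{3}{2}-\sqrt{\frac{2}{5}}\right) n \approx 0.867544\, n.$$
   Context: For integers $n\ge 1$ and $k$, $r_k(n)$ denotes the number of ways to divide a $2\times n$ rectangular strip of $2n$ unit squares (2 rows, $n$ columns) into exactly $k$ pieces by cutting only along edges of the unit squares, each piece being an edge-connected union of unit squares (equivalently, partitions of the vertex set of the ladder graph $P_2\times P_n$ into $k$ blocks each inducing a connected subgraph). All divisions of a given strip are considered equally likely. *)

theory Defs
  imports "HOL-Analysis.Analysis" "HOL-Library.Disjoint_Sets" "HOL-Library.Landau_Symbols"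
begin

text \<open>A unit square is named by its (row, column) coordinates.\<close>

type_synonym square = "nat \<times> nat"

definition strip :: "nat \<Rightarrow> square set" where
  "strip n = {..<2} \<times> {..<n}"

text \<open>Two unit squares of the grid have a common edge iff their coordinates differ by exactly
  one in exactly one direction.\<close>

definition share_edge :: "(square \<times> square) set" where
  "share_edge = {((i, j), (i', j')). \<bar>int i - int i'\<bar> + \<bar>int j - int j'\<bar> = 1}"

text \<open>The path joining two squares of a piece must stay inside the piece.\<close>

definition edge_connected :: "square set \<Rightarrow> bool" where
  "edge_connected B \<longleftrightarrow> (\<forall>x\<in>B. \<forall>y\<in>B. (x, y) \<in> (share_edge \<inter> B \<times> B)\<^sup>*)"

definition divisions :: "nat \<Rightarrow> square set set set" where
  "divisions n = {P. partition_on (strip n) P \<and> (\<forall>B\<in>P. edge_connected B)}"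

definition r :: "nat \<Rightarrow> nat \<Rightarrow> nat" where
  "r k n = card {P \<in> divisions n. card P = k}"

text \<open>A division of the strip has at most \<open>2 * n\<close> pieces, so the sums below contain every
  nonzero term; see \<open>r_eq_0\<close>.\<close>

definition expected_pieces :: "nat \<Rightarrow> real" where
  "expected_pieces n =
    (\<Sum>k\<le>2 * n. real k * real (r k n)) / (\<Sum>k\<le>2 * n. real (r k n))"

lemma r_eq_0:
  assumes "k > 2 * n"
  shows "r k n = 0"
proof -
  have "card P \<le> 2 * n" if P: "partition_on (strip n) P" for P
  proof -
    have fin: "finite (strip n)" by (simp add: strip_def)
    have "finite P" using finite_elements[OF fin P] .
    moreover have "finite B \<and> B \<noteq> {}" if "B \<in> P" for B
      using P that fin unfolding partition_on_def by (metis Sup_upper finite_subset)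
    ultimately have "card P \<le> (\<Sum>B\<in>P. card B)"
      using sum_mono[of P "\<lambda>_. 1" card] by (simp add: Suc_leI card_gt_0_iff)
    also have "\<dots> = card (strip n)"
      using product_partition[OF P] \<open>\<And>B. B \<in> P \<Longrightarrow> finite B \<and> B \<noteq> {}\<close> by simp
    finally show ?thesis by (simp add: strip_def)
  qed
  with assms have "{P \<in> divisions n. card P = k} = {}"
    by (auto simp: divisions_def dest: leD)
  then show ?thesis by (simp only: r_def card.empty)
qed

end

theory Submission
  imports Defs
begin

text \<open>The strip is built column by column. The two old squares next to the new column are adjacent,
  so removing the new column from a division leaves connected pieces, and how a division extends
  depends only on whether these two squares lie in the same piece. The numbers of divisions of both
  kinds therefore satisfy a linear recursion with matrix \<open>((2, 3), (3, 4))\<close>, whose eigenvalues are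
  \<open>3 + sqrt 10\<close> and \<open>3 - sqrt 10\<close>, and the total numbers of pieces satisfy the same recursion with a
  forcing term. The latter is solved in closed form in terms of the former, and the dominant
  eigenvector gives the limit of the ratio.\<close>

section \<open>Partitions of a set with one further element\<close>

text \<open>Taking \<open>B = {}\<close> encodes the choice of opening the new block
  \<open>{u}\<close>, so that all choices for \<open>u\<close> are indexed by
  \<open>insert {} Q\<close>.\<close>

definition add_to_block :: "'a \<Rightarrow> 'a set \<Rightarrow> 'a set set \<Rightarrow> 'a set set" where
  "add_to_block u B Q = insert (insert u B) (Q - {B})"

lemma partition_on_add_to_block:
  assumes "partition_on V Q" "u \<notin> V" "B \<in> insert {} Q"
  shows "partition_on (insert u V) (add_to_block u B Q)"
proof -
  have d: "\<And>C D. C \<in> Q \<Longrightarrow> D \<in> Q \<Longrightarrow> C \<noteq> D \<Longrightarrow> C \<inter> D = {}"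
    and V: "V = \<Union>Q" and ne: "{} \<notin> Q"
    using assms(1) by (auto simp: partition_on_def disjoint_def)
  have "\<Union>(add_to_block u B Q) = insert u V"
    using assms(3) V by (auto simp: add_to_block_def)
  moreover have "disjoint (add_to_block u B Q)"
  proof (unfold disjoint_def, intro ballI impI)
    fix C D assume "C \<in> add_to_block u B Q" "D \<in> add_to_block u B Q" "C \<noteq> D"
    moreover have "insert u B \<inter> E = {}" if "E \<in> Q - {B}" for E
      using that d[of B E] assms V by auto
    ultimately show "C \<inter> D = {}"
      using d[of C D] unfolding add_to_block_def by blast
  qed
  ultimately show ?thesis
    using ne by (auto simp: partition_on_def add_to_block_def)
qed

lemma card_add_to_block:
  assumes "partition_on V Q" "finite V" "u \<notin> V" "B \<in> insert {} Q"
  shows "card (add_to_block u B Q) = card Q + of_bool (B = {})"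
proof -
  have "finite Q" using finite_elements[OF assms(2,1)] .
  have "{} \<notin> Q" "insert u B \<notin> Q"
    using assms by (auto simp: partition_on_def)
  show ?thesis
  proof (cases "B = {}")
    case True
    with \<open>finite Q\<close> \<open>{} \<notin> Q\<close> \<open>insert u B \<notin> Q\<close> show ?thesis
      by (simp add: add_to_block_def)
  next
    case False
    with assms have "B \<in> Q" by simp
    with \<open>finite Q\<close> have "card Q > 0" by (auto simp: card_gt_0_iff)
    with False \<open>B \<in> Q\<close> \<open>finite Q\<close> \<open>insert u B \<notin> Q\<close> show ?thesis
      by (simp add: add_to_block_def card.insert_remove)
  qed
qed

text \<open>Deleting \<open>u\<close> from a partition \<open>P\<close> yields \<open>Q\<close>, and
  what is left of the block of \<open>u\<close> is \<open>B\<close>; this inverts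
  \<open>add_to_block\<close>, so each \<open>P\<close> arises from exactly one pair. The free
  summand \<open>h\<close> allows the lemma to be applied twice, once for each square of a
  column.\<close>

lemma sum_partition_on_insert:
  fixes h :: "'a set set \<Rightarrow> 'b::comm_monoid_add"
  assumes "finite V" "u \<notin> V"
  shows "(\<Sum>P | partition_on (insert u V) P. h P) =
    (\<Sum>Q | partition_on V Q. \<Sum>B\<in>insert {} Q. h (add_to_block u B Q))"
proof -
  \<comment> \<open>These recover \<open>B\<close> and \<open>Q\<close> from \<open>P\<close>. The
    union picks the block of \<open>u\<close> without a choice, and removing \<open>{}\<close>
    covers the case that \<open>{u}\<close> was a block.\<close>
  let ?blk = "\<lambda>P. \<Union>{D \<in> P. u \<in> D} - {u}"
  let ?rest = "\<lambda>P. (\<lambda>D. D - {u}) ` P - {{}}"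
  have fin: "finite {Q. partition_on V Q}"
    using finitely_many_partition_on[OF assms(1)] .
  have finQ: "finite (insert {} Q)" if "partition_on V Q" for Q
    using finite_elements[OF assms(1) that] by simp
  have "(\<Sum>P | partition_on (insert u V) P. h P) =
    (\<Sum>(Q, B)\<in>(SIGMA Q:{Q. partition_on V Q}. insert {} Q). h (add_to_block u B Q))"
  proof (rule sum.reindex_bij_witness[where i = "\<lambda>(Q, B). add_to_block u B Q"
        and j = "\<lambda>P. (?rest P, ?blk P)"])
    fix P assume "P \<in> {P. partition_on (insert u V) P}"
    then have P: "partition_on (insert u V) P" by simp
    have d: "\<And>C D. C \<in> P \<Longrightarrow> D \<in> P \<Longrightarrow> C \<noteq> D \<Longrightarrow> C \<inter> D = {}"
      and V: "insert u V = \<Union>P" and ne: "{} \<notin> P"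
      using P by (auto simp: partition_on_def disjoint_def)
    obtain D where D: "D \<in> P" "u \<in> D" using V by blast
    have un: "u \<notin> E" if "E \<in> P - {D}" for E
      using that d[of D E] D by auto
    have blk: "?blk P = D - {u}"
      using D un by blast
    \<comment> \<open>\<open>add_to_block\<close> deletes \<open>D - {u}\<close> from the rest; this
      must not remove some other block of \<open>P\<close>.\<close>
    have dis: "D - {u} \<notin> P - {D}"
    proof
      assume "D - {u} \<in> P - {D}"
      with d[of D "D - {u}"] D have "D - {u} = {}" by blast
      with ne \<open>D - {u} \<in> P - {D}\<close> show False by simp
    qed
    have "(\<lambda>E. E - {u}) ` (P - {D}) = P - {D}"
      using un by force
    then have "(\<lambda>E. E - {u}) ` insert D (P - {D}) = insert (D - {u}) (P - {D})"
      by (simp only: image_insert)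
    moreover have "insert D (P - {D}) = P" using D by blast
    ultimately have rest: "?rest P = insert (D - {u}) (P - {D}) - {{}}"
      by (simp only:)
    have "insert (D - {u}) (P - {D}) - {{}} - {D - {u}} = P - {D}"
      using dis ne by blast
    moreover have "insert u (D - {u}) = D" using D by blast
    ultimately have "add_to_block u (D - {u}) (?rest P) = P"
      unfolding rest add_to_block_def using D by (simp only: insert_Diff)
    then show "(case (?rest P, ?blk P) of (Q, B) \<Rightarrow> add_to_block u B Q) = P"
      unfolding blk by simp
    then show "(case (?rest P, ?blk P) of (Q, B) \<Rightarrow> h (add_to_block u B Q)) = h P"
      by simp
    have "\<Union>(?rest P) = \<Union>P - {u}" by blast
    also have "\<dots> = V" using V assms(2) by blast
    finally have "\<Union>(?rest P) = V" .
    moreover have "disjoint (?rest P)"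
      unfolding rest disjoint_def using d D by blast
    ultimately have "partition_on V (?rest P)"
      unfolding partition_on_def by blast
    then show "(?rest P, ?blk P) \<in> (SIGMA Q:{Q. partition_on V Q}. insert {} Q)"
      unfolding blk rest by blast
  next
    fix z assume "z \<in> (SIGMA Q:{Q. partition_on V Q}. insert {} Q)"
    then obtain Q B where z: "z = (Q, B)" "partition_on V Q" "B \<in> insert {} Q" by auto
    have un: "u \<notin> E" if "E \<in> insert {} Q" for E
      using that z(2) assms(2) by (auto simp: partition_on_def)
    have ne: "{} \<notin> Q" using z(2) by (auto simp: partition_on_def)
    have blk: "?blk (add_to_block u B Q) = B"
      using un z(3) unfolding add_to_block_def by blast
    have "(\<lambda>E. E - {u}) ` (Q - {B}) = Q - {B}"
      using un by force
    moreover have "insert u B - {u} = B" using un z(3) by auto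
    ultimately have "?rest (add_to_block u B Q) = insert B (Q - {B}) - {{}}"
      unfolding add_to_block_def by simp
    also have "\<dots> = Q" using ne z(3) by auto
    finally show "(?rest (case z of (Q, B) \<Rightarrow> add_to_block u B Q),
        ?blk (case z of (Q, B) \<Rightarrow> add_to_block u B Q)) = z"
      unfolding z prod.case using blk by simp
    show "(case z of (Q, B) \<Rightarrow> add_to_block u B Q) \<in> {P. partition_on (insert u V) P}"
      using partition_on_add_to_block[OF z(2) assms(2) z(3)] z(1) by simp
  qed
  also have "\<dots> = (\<Sum>Q | partition_on V Q. \<Sum>B\<in>insert {} Q. h (add_to_block u B Q))"
    using fin finQ by (subst sum.Sigma) auto
  finally show ?thesis .
qed

section \<open>Edge-connected sets and the boundary of a strip\<close>

lemma sym_share_edge: "sym share_edge"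
  by (auto simp: share_edge_def sym_def)

lemma edge_connected_singleton [simp]: "edge_connected {a}"
  by (simp add: edge_connected_def)

lemma edge_connected_insert:
  assumes "edge_connected B" "b \<in> B" "(b, c) \<in> share_edge"
  shows "edge_connected (insert c B)"
proof -
  let ?R = "(share_edge \<inter> insert c B \<times> insert c B)\<^sup>*"
  have mono: "(p, q) \<in> ?R" if "(p, q) \<in> (share_edge \<inter> B \<times> B)\<^sup>*" for p q
    by (rule subsetD[OF rtrancl_mono that]) auto
  have "sym ?R"
    by (intro sym_rtrancl sym_Int sym_share_edge) (auto simp: sym_def)
  have "(b, c) \<in> ?R" using assms by auto
  then have *: "(p, c) \<in> ?R" if "p \<in> insert c B" for p
    using that assms mono unfolding edge_connected_def by (blast intro: rtrancl_trans)
  then have "(c, p) \<in> ?R" if "p \<in> insert c B" for p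
    using that \<open>sym ?R\<close> by (blast dest: symD)
  with * show ?thesis
    unfolding edge_connected_def by (blast intro: rtrancl_trans)
qed

text \<open>Some step of a path from \<open>a\<close> to \<open>b\<close> must leave
  \<open>S\<close>. This is the tool for showing that a piece cannot contain a new square without
  touching it.\<close>

lemma edge_connected_exit:
  assumes "edge_connected B" "a \<in> B" "a \<in> S" "b \<in> B" "b \<notin> S"
  obtains p q where "p \<in> B" "p \<in> S" "q \<in> B" "q \<notin> S" "(p, q) \<in> share_edge"
proof -
  have "(a, b) \<in> (share_edge \<inter> B \<times> B)\<^sup>*"
    using assms by (auto simp: edge_connected_def)
  then have "b \<in> S \<or> (\<exists>p q. p \<in> B \<and> p \<in> S \<and> q \<in> B \<and> q \<notin> S \<and> (p, q) \<in> share_edge)"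
    by (induction rule: rtrancl_induct) (use assms in blast)+
  with assms that show thesis by blast
qed

text \<open>A path leaving \<open>V\<close> can be short-cut, because its exit and re-entry points are adjacent.\<close>

lemma edge_connected_Int:
  assumes "edge_connected B"
    and clique: "\<And>p q p' q'. p \<in> B \<inter> V \<Longrightarrow> q \<in> B \<inter> V \<Longrightarrow> p' \<in> B - V \<Longrightarrow> q' \<in> B - V \<Longrightarrow>
      (p, p') \<in> share_edge \<Longrightarrow> (q, q') \<in> share_edge \<Longrightarrow> p = q \<or> (p, q) \<in> share_edge"
  shows "edge_connected (B \<inter> V)"
  unfolding edge_connected_def
proof (intro ballI)
  let ?R = "(share_edge \<inter> (B \<inter> V) \<times> (B \<inter> V))\<^sup>*"
  fix a b assume a: "a \<in> B \<inter> V" and b: "b \<in> B \<inter> V"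
  have "(a, b) \<in> (share_edge \<inter> B \<times> B)\<^sup>*"
    using assms(1) a b by (auto simp: edge_connected_def)
  \<comment> \<open>Invariant along the path: at a square outside \<open>V\<close>, remember a
    square \<open>p\<close> of \<open>V\<close> from which the path went out and which is reachable
    inside \<open>V\<close>. On re-entry at \<open>d\<close>, the clique condition makes
    \<open>p\<close> equal or adjacent to \<open>d\<close>.\<close>
  then have "if b \<in> V then (a, b) \<in> ?R
    else \<exists>p p'. p \<in> B \<inter> V \<and> p' \<in> B - V \<and> (p, p') \<in> share_edge \<and> (a, p) \<in> ?R"
  proof (induction rule: rtrancl_induct)
    case base
    then show ?case using a by simp
  next
    case (step c d)
    then have cd: "c \<in> B" "d \<in> B" "(c, d) \<in> share_edge" "(d, c) \<in> share_edge"
      using sym_share_edge by (auto dest: symD)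
    show ?case
    proof (cases "c \<in> V")
      case True
      with step.IH have "(a, c) \<in> ?R" by simp
      show ?thesis
      proof (cases "d \<in> V")
        assume "d \<in> V"
        with \<open>(a, c) \<in> ?R\<close> True cd have "(a, d) \<in> ?R"
          by (blast intro: rtrancl_into_rtrancl)
        with \<open>d \<in> V\<close> show ?thesis by simp
      next
        assume "d \<notin> V"
        with \<open>(a, c) \<in> ?R\<close> True cd show ?thesis by (simp only: if_False) blast
      qed
    next
      case False
      with step.IH obtain p p' where p: "p \<in> B \<inter> V" "p' \<in> B - V" "(p, p') \<in> share_edge"
        "(a, p) \<in> ?R" by auto
      show ?thesis
      proof (cases "d \<in> V")
        case True
        then have "p = d \<or> (p, d) \<in> share_edge"
          using clique[OF p(1) _ p(2) _ p(3) cd(4)] cd False by auto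
        with p cd(2) True have "(a, d) \<in> ?R"
          by (blast intro: rtrancl_into_rtrancl)
        with True show ?thesis by simp
      next
        case False
        with p show ?thesis by (simp only: if_False) blast
      qed
    qed
  qed
  with b show "(a, b) \<in> ?R" by simp
qed

text \<open>Columns are numbered from 0: \<open>linked n\<close> speaks about the last column of \<open>strip (Suc n)\<close>.\<close>

definition linked :: "nat \<Rightarrow> square set set \<Rightarrow> bool" where
  "linked n P \<longleftrightarrow> (\<exists>B\<in>P. (0, n) \<in> B \<and> (1, n) \<in> B)"

lemma strip_Suc: "strip (Suc n) = insert (1, n) (insert (0, n) (strip n))"
  by (auto simp: strip_def less_Suc_eq numeral_2_eq_2)

lemma finite_strip [simp]: "finite (strip n)"
  by (simp add: strip_def)

lemma share_edge_new_column:
  assumes "p \<in> strip (Suc n)" "i < 2" "(p, (i, Suc n)) \<in> share_edge"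
  shows "p = (i, n)"
  using assms by (cases p) (auto simp: strip_def share_edge_def)

lemma share_edge_intros:
  "((0, n), (1, n)) \<in> share_edge" "((1, n), (0, n)) \<in> share_edge"
  "((i, n), (i, Suc n)) \<in> share_edge"
  by (auto simp: share_edge_def)

text \<open>Only \<open>(0, n)\<close> and \<open>(1, n)\<close> have a neighbour in the next
  column, and they are adjacent, so the clique condition of \<open>edge_connected_Int\<close>
  holds.\<close>

lemma edge_connected_Int_strip:
  assumes "edge_connected B" "B \<subseteq> strip (Suc (Suc n))"
  shows "edge_connected (B \<inter> strip (Suc n))"
proof (rule edge_connected_Int[OF assms(1)])
  have *: "p \<in> {(0, n), (1, n)}"
    if pp': "p \<in> B \<inter> strip (Suc n)" "p' \<in> B - strip (Suc n)" "(p, p') \<in> share_edge" for p p'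
  proof -
    obtain i where "p' = (i, Suc n)" "i < 2"
      using pp'(2) assms(2) by (auto simp: strip_Suc[of "Suc n"])
    with pp' share_edge_new_column[of p n i] show ?thesis by (auto simp: less_2_cases_iff)
  qed
  fix p q p' q'
  assume "p \<in> B \<inter> strip (Suc n)" "q \<in> B \<inter> strip (Suc n)" "p' \<in> B - strip (Suc n)"
    "q' \<in> B - strip (Suc n)" "(p, p') \<in> share_edge" "(q, q') \<in> share_edge"
  with *[of p p'] *[of q q'] show "p = q \<or> (p, q) \<in> share_edge"
    using share_edge_intros(1,2)[of n] by auto
qed

section \<open>Extending a partition by one column\<close>

context
  fixes n :: nat and Q :: "square set set" and X Y B C :: "square set"
    and u v :: square
  \<comment> \<open>\<open>X\<close> and \<open>Y\<close> contain the left neighbours of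
    \<open>u\<close> and \<open>v\<close> and may coincide. First \<open>u\<close> is put into
    \<open>B\<close>, then \<open>v\<close> into \<open>C\<close>, which may be the block just made
    for \<open>u\<close>; as before, \<open>{}\<close> stands for a new block.\<close>
  assumes Q: "partition_on (strip (Suc n)) Q"
    and X: "X \<in> Q" "(0, n) \<in> X" and Y: "Y \<in> Q" "(1, n) \<in> Y"
    and B: "B \<in> insert {} Q" and C: "C \<in> insert {} (add_to_block u B Q)"
    and u: "u = (0, Suc n)" and v: "v = (1, Suc n)"
begin

lemma new_column_notin:
  "u \<notin> strip (Suc n)" "v \<notin> insert u (strip (Suc n))"
  by (auto simp: u v strip_def)

lemma block_subset: "D \<in> insert {} Q \<Longrightarrow> D \<subseteq> strip (Suc n)"
  using Q by (auto simp: partition_on_def)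

lemma block_eq: "D \<in> insert {} Q \<Longrightarrow> D' \<in> Q \<Longrightarrow> z \<in> D \<Longrightarrow> z \<in> D' \<Longrightarrow> D = D'"
  using Q by (auto simp: partition_on_def disjoint_def)

lemma old_block: "C \<noteq> insert u B \<Longrightarrow> C \<in> insert {} (Q - {B})"
  using C by (auto simp: add_to_block_def)

lemma add_column_joined:
  assumes "C = insert u B"
  shows "add_to_block v C (add_to_block u B Q) = insert (insert v (insert u B)) (Q - {B})"
  using assms block_subset new_column_notin by (auto simp: add_to_block_def)

lemma add_column_separate:
  assumes "C \<noteq> insert u B"
  shows "add_to_block v C (add_to_block u B Q) =
    insert (insert v C) (insert (insert u B) (Q - {B} - {C}))"
  using assms by (auto simp: add_to_block_def)

lemma linked_add_column:
  "linked (Suc n) (add_to_block v C (add_to_block u B Q)) \<longleftrightarrow> C = insert u B"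
proof (cases "C = insert u B")
  case True
  then show ?thesis
    unfolding linked_def add_column_joined[OF True] by (simp add: u v)
next
  case False
  have "C \<subseteq> strip (Suc n)" "B \<subseteq> strip (Suc n)"
    using block_subset B old_block[OF False] by auto
  then have "u \<notin> insert v C" "v \<notin> insert u B" "u \<noteq> v"
    using new_column_notin by (auto simp: u v)
  moreover have "u \<notin> D" if "D \<in> Q" for D
    using that block_subset new_column_notin by blast
  ultimately show ?thesis
    using False unfolding linked_def add_column_separate[OF False] by (auto simp: u v)
qed

lemma card_add_column:
  "card (add_to_block v C (add_to_block u B Q)) = card Q + of_bool (B = {}) + of_bool (C = {})"
  using card_add_to_block[OF partition_on_add_to_block[OF Q new_column_notin(1) B] _
      new_column_notin(2) C] card_add_to_block[OF Q _ new_column_notin(1) B]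
  by simp

text \<open>Every old block is the trace on the old strip of some new block, and such traces stay
  connected by \<open>edge_connected_Int_strip\<close>.\<close>

lemma edge_connected_old_blocks:
  assumes "\<forall>D\<in>add_to_block v C (add_to_block u B Q). edge_connected D" "D \<in> Q"
  shows "edge_connected D"
proof -
  have W: "strip (Suc (Suc n)) = insert v (insert u (strip (Suc n)))"
    using strip_Suc[of "Suc n"] unfolding u v .
  have Bs: "B \<subseteq> strip (Suc n)" and Ds: "D \<subseteq> strip (Suc n)"
    using block_subset B assms(2) by blast+
  have *: ?thesis if "D' \<in> add_to_block v C (add_to_block u B Q)" "D' \<subseteq> strip (Suc (Suc n))"
    "D' \<inter> strip (Suc n) = D" for D'
    using edge_connected_Int_strip[of D' n] assms(1) that by simp
  show ?thesis
  proof (cases "C = insert u B")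
    case True
    have "insert v (insert u B) \<inter> strip (Suc n) = B"
      using Bs new_column_notin by auto
    with *[of D] *[of "insert v (insert u B)"] assms(2) Bs Ds show ?thesis
      unfolding add_column_joined[OF True] W by (cases "D = B") auto
  next
    case False
    have Cs: "C \<subseteq> strip (Suc n)" using old_block[OF False] block_subset by blast
    have "insert v C \<inter> strip (Suc n) = C" "insert u B \<inter> strip (Suc n) = B"
      using Bs Cs new_column_notin by auto
    with *[of D] *[of "insert v C"] *[of "insert u B"] assms(2) Bs Cs Ds show ?thesis
      unfolding add_column_separate[OF False] W by (cases "D = B"; cases "D = C") auto
  qed
qed

text \<open>A path from \<open>D\<close> to the new square has to leave \<open>D\<close> at a
  neighbour of that square, and its only neighbour in the old strip is the one to its left.\<close>

lemma edge_connected_insert_new: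
  assumes "D \<in> insert {} Q" "i < 2" "edge_connected (insert (i, Suc n) D)" "D \<noteq> {}"
  shows "(i, n) \<in> D"
proof -
  have D: "D \<subseteq> strip (Suc n)" using block_subset[OF assms(1)] .
  then have "(i, Suc n) \<notin> D" by (auto simp: strip_def)
  from assms(4) obtain a where "a \<in> D" by auto
  obtain p q where "p \<in> insert (i, Suc n) D" "p \<in> D" "q \<in> insert (i, Suc n) D" "q \<notin> D"
    "(p, q) \<in> share_edge"
    using edge_connected_exit[OF assms(3), of a D "(i, Suc n)"] \<open>a \<in> D\<close> \<open>(i, Suc n) \<notin> D\<close>
    by blast
  with D assms(2) share_edge_new_column[of p n i] show ?thesis by auto
qed

text \<open>If \<open>u\<close> and \<open>v\<close> lie in different blocks, each can be attached
  only through its horizontal edge, hence to \<open>X\<close> and \<open>Y\<close> respectively. If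
  they share a block, the edge between them lets one horizontal edge serve both, so either
  \<open>X\<close> or \<open>Y\<close> will do.\<close>

lemma edge_connected_add_column:
  "(\<forall>D\<in>add_to_block v C (add_to_block u B Q). edge_connected D) \<longleftrightarrow>
    (\<forall>D\<in>Q. edge_connected D) \<and>
    (if C = insert u B then B \<in> {{}, X, Y} else B \<in> {{}, X} \<and> C \<in> {{}, Y})"
  (is "?conn \<longleftrightarrow> ?old \<and> ?valid")
proof
  assume conn: ?conn
  have ?valid
  proof (cases "C = insert u B")
    case True
    have "B \<in> {{}, X, Y}"
    proof (rule ccontr)
      assume "\<not> B \<in> {{}, X, Y}"
      then obtain a where a: "a \<in> B" and BXY: "B \<noteq> X" "B \<noteq> Y" by auto
      have Bs: "B \<subseteq> strip (Suc n)" using block_subset[OF B] .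
      have "edge_connected (insert v (insert u B))"
        using conn unfolding add_column_joined[OF True] by simp
      \<comment> \<open>An exit from \<open>B\<close> leads into the new column, so it starts at
        \<open>(0, n)\<close> or \<open>(1, n)\<close>; then \<open>B\<close> is \<open>X\<close> or
        \<open>Y\<close>.\<close>
      then obtain p q where pq: "p \<in> B" "q \<in> insert v (insert u B)" "q \<notin> B" "(p, q) \<in> share_edge"
        using a new_column_notin Bs by (elim edge_connected_exit[of _ a B u]) auto
      then have "p \<in> {(0, n), (1, n)}"
        using Bs share_edge_new_column[of p n 0] share_edge_new_column[of p n 1]
        by (auto simp: u v)
      with pq(1) BXY X Y B show False using block_eq by blast
    qed
    with True show ?thesis by simp
  next
    case False
    have C': "C \<in> insert {} Q" using old_block[OF False] by auto
    have cn: "edge_connected (insert (0, Suc n) B)" "edge_connected (insert (1, Suc n) C)"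
      using conn unfolding add_column_separate[OF False] by (simp_all add: u v)
    have "B = X" if "B \<noteq> {}"
      using edge_connected_insert_new[OF B _ cn(1) that] block_eq[OF B X(1) _ X(2)] by simp
    moreover have "C = Y" if "C \<noteq> {}"
      using edge_connected_insert_new[OF C' _ cn(2) that] block_eq[OF C' Y(1) _ Y(2)] by simp
    ultimately show ?thesis using False by auto
  qed
  with edge_connected_old_blocks[OF conn] show "?old \<and> ?valid" by blast
next
  assume "?old \<and> ?valid"
  then have old: ?old and valid: ?valid by blast+
  have xu: "((0, n), u) \<in> share_edge" and yv: "((1, n), v) \<in> share_edge"
    and uv: "(u, v) \<in> share_edge" "(v, u) \<in> share_edge"
    unfolding u v by (rule share_edge_intros)+
  have Xu: "edge_connected (insert u X)"
    using edge_connected_insert[OF _ X(2) xu] old X(1) by blast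
  have Yv: "edge_connected (insert v Y)"
    using edge_connected_insert[OF _ Y(2) yv] old Y(1) by blast
  show ?conn
  proof (cases "C = insert u B")
    case True
    have "edge_connected (insert v (insert u X))"
      using edge_connected_insert[OF Xu _ uv(1)] by simp
    \<comment> \<open>Here the order of attachment is reversed: \<open>v\<close> touches
      \<open>Y\<close>, and \<open>u\<close> follows through \<open>v\<close>.\<close>
    moreover have "edge_connected (insert v (insert u Y))"
      using edge_connected_insert[OF Yv _ uv(2)] by (simp add: insert_commute)
    moreover have "edge_connected (insert v {u})"
      using edge_connected_insert[OF edge_connected_singleton _ uv(1)] by simp
    ultimately have "edge_connected (insert v (insert u B))"
      using valid True by auto
    then show ?thesis
      unfolding add_column_joined[OF True] using old by auto
  next
    case False
    with valid Xu Yv have "edge_connected (insert u B)" "edge_connected (insert v C)"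
      by auto
    then show ?thesis
      unfolding add_column_separate[OF False] using old by auto
  qed
qed

end

section \<open>Recursions for weighted sums over divisions\<close>

lemma finite_divisions [simp]: "finite (divisions n)"
  by (rule finite_subset[OF _ finitely_many_partition_on[OF finite_strip[of n]]])
    (auto simp: divisions_def)

text \<open>The weight \<open>g\<close> is kept general so that one recursion serves both the number
  of divisions (\<open>g\<close> constantly 1) and the total number of pieces
  (\<open>g = real\<close>).\<close>

definition linked_sum :: "(nat \<Rightarrow> real) \<Rightarrow> nat \<Rightarrow> real" where
  "linked_sum g n = (\<Sum>P | P \<in> divisions (Suc n) \<and> linked n P. g (card P))"

definition unlinked_sum :: "(nat \<Rightarrow> real) \<Rightarrow> nat \<Rightarrow> real" where
  "unlinked_sum g n = (\<Sum>P | P \<in> divisions (Suc n) \<and> \<not> linked n P. g (card P))"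

text \<open>Two applications of \<open>sum_partition_on_insert\<close>. Connectivity is tested only
  on the completed column, because removing just \<open>(1, n)\<close> from a division can
  disconnect a piece.\<close>

lemma sum_divisions_Suc:
  fixes h :: "square set set \<Rightarrow> real"
  shows "(\<Sum>P | P \<in> divisions (Suc n) \<and> R P. h P) =
    (\<Sum>Q | partition_on (strip n) Q. \<Sum>B\<in>insert {} Q. \<Sum>C\<in>insert {} (add_to_block (0, n) B Q).
      let P = add_to_block (1, n) C (add_to_block (0, n) B Q)
      in if (\<forall>D\<in>P. edge_connected D) \<and> R P then h P else 0)"
proof -
  let ?h = "\<lambda>P. if (\<forall>D\<in>P. edge_connected D) \<and> R P then h P else 0"
  have "(\<Sum>P | P \<in> divisions (Suc n) \<and> R P. h P) =
    (\<Sum>P | partition_on (strip (Suc n)) P. ?h P)"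
    using finitely_many_partition_on[OF finite_strip[of "Suc n"]]
    by (subst sum.inter_filter[symmetric]) (auto simp: divisions_def intro!: sum.cong)
  also have "\<dots> = (\<Sum>Q | partition_on (insert (0, n) (strip n)) Q.
      \<Sum>C\<in>insert {} Q. ?h (add_to_block (1, n) C Q))"
    unfolding strip_Suc by (rule sum_partition_on_insert) (auto simp: strip_def)
  also have "\<dots> = (\<Sum>Q | partition_on (strip n) Q. \<Sum>B\<in>insert {} Q.
      \<Sum>C\<in>insert {} (add_to_block (0, n) B Q). ?h (add_to_block (1, n) C (add_to_block (0, n) B Q)))"
    by (rule sum_partition_on_insert) (auto simp: strip_def)
  finally show ?thesis by (simp only: Let_def)
qed

lemma partition_on_strip_blocks:
  assumes "partition_on (strip (Suc n)) Q"
  obtains X Y where "X \<in> Q" "(0, n) \<in> X" "Y \<in> Q" "(1, n) \<in> Y" "linked n Q \<longleftrightarrow> X = Y"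
proof -
  have "(0, n) \<in> \<Union>Q" "(1, n) \<in> \<Union>Q"
    using assms by (auto simp: partition_on_def strip_def)
  then obtain X Y where XY: "X \<in> Q" "(0, n) \<in> X" "Y \<in> Q" "(1, n) \<in> Y" by blast
  moreover have "D = X" if "D \<in> Q" "(0, n) \<in> D" for D
    using assms that XY(1,2) by (auto simp: partition_on_def disjoint_def)
  moreover have "D = Y" if "D \<in> Q" "(1, n) \<in> D" for D
    using assms that XY(3,4) by (auto simp: partition_on_def disjoint_def)
  ultimately show thesis using that unfolding linked_def by metis
qed

text \<open>The pair \<open>u\<close>, \<open>v\<close> either forms a new piece or joins
  \<open>X\<close> or \<open>Y\<close>; the last two choices are the same one when
  \<open>X = Y\<close>.\<close>

lemma linked_extensions:
  assumes "partition_on (strip (Suc n)) Q"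
  defines "u \<equiv> (0, Suc n)" and "v \<equiv> (1, Suc n)"
  shows "(\<Sum>B\<in>insert {} Q. \<Sum>C\<in>insert {} (add_to_block u B Q).
      let P = add_to_block v C (add_to_block u B Q)
      in if (\<forall>D\<in>P. edge_connected D) \<and> linked (Suc n) P then g (card P) else 0) =
    (if \<forall>D\<in>Q. edge_connected D
     then g (card Q + 1) + (if linked n Q then 1 else 2) * g (card Q) else (0::real))"
    (is "?lhs = ?rhs")
proof -
  obtain X Y where XY: "X \<in> Q" "(0, n) \<in> X" "Y \<in> Q" "(1, n) \<in> Y"
    and lnk: "linked n Q \<longleftrightarrow> X = Y"
    using partition_on_strip_blocks[OF assms(1)] .
  have finQ: "finite Q" using finite_elements[OF finite_strip assms(1)] .
  have ne: "X \<noteq> {}" "Y \<noteq> {}" using XY by auto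
  let ?conn = "\<forall>D\<in>Q. edge_connected D"
  have "?lhs = (\<Sum>B\<in>insert {} Q. \<Sum>C\<in>insert {} (add_to_block u B Q).
    if insert u B = C then (if ?conn \<and> B \<in> {{}, X, Y} then g (card Q + of_bool (B = {})) else 0) else 0)"
  proof (intro sum.cong refl)
    fix B C assume B: "B \<in> insert {} Q" and C: "C \<in> insert {} (add_to_block u B Q)"
    note e = assms(1) XY B C meta_eq_to_obj_eq[OF u_def] meta_eq_to_obj_eq[OF v_def]
    show "(let P = add_to_block v C (add_to_block u B Q)
      in if (\<forall>D\<in>P. edge_connected D) \<and> linked (Suc n) P then g (card P) else 0) =
      (if insert u B = C then (if ?conn \<and> B \<in> {{}, X, Y} then g (card Q + of_bool (B = {})) else 0) else 0)"
      unfolding Let_def edge_connected_add_column[OF e] linked_add_column[OF e] card_add_column[OF e]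
      by auto
  qed
  \<comment> \<open>For each \<open>B\<close> the inner sum collapses to its single term
    \<open>C = insert u B\<close>.\<close>
  also have "\<dots> = (\<Sum>B\<in>insert {} Q.
      if ?conn \<and> B \<in> {{}, X, Y} then g (card Q + of_bool (B = {})) else 0)"
    using finQ by (intro sum.cong refl) (simp add: sum.delta' add_to_block_def)
  also have "\<dots> = (\<Sum>B\<in>{{}, X, Y}. if ?conn then g (card Q + of_bool (B = {})) else 0)"
    using finQ XY by (intro sum.mono_neutral_cong_right) auto
  also have "\<dots> = ?rhs"
    using ne lnk by (cases ?conn; cases "X = Y") (simp_all only: if_True if_False, auto)
  finally show ?thesis .
qed

text \<open>Each of \<open>u\<close> and \<open>v\<close> either opens a piece or joins the piece to
  its left: two new pieces in one way, one in two ways, none in one way. The last is impossible when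
  \<open>X = Y\<close>, since it would put \<open>u\<close> and \<open>v\<close> together.\<close>

lemma unlinked_extensions:
  assumes "partition_on (strip (Suc n)) Q"
  defines "u \<equiv> (0, Suc n)" and "v \<equiv> (1, Suc n)"
  shows "(\<Sum>B\<in>insert {} Q. \<Sum>C\<in>insert {} (add_to_block u B Q).
      let P = add_to_block v C (add_to_block u B Q)
      in if (\<forall>D\<in>P. edge_connected D) \<and> \<not> linked (Suc n) P then g (card P) else 0) =
    (if \<forall>D\<in>Q. edge_connected D
     then g (card Q + 2) + 2 * g (card Q + 1) + (if linked n Q then 0 else g (card Q))
     else (0::real))"
    (is "?lhs = ?rhs")
proof -
  obtain X Y where XY: "X \<in> Q" "(0, n) \<in> X" "Y \<in> Q" "(1, n) \<in> Y"
    and lnk: "linked n Q \<longleftrightarrow> X = Y"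
    using partition_on_strip_blocks[OF assms(1)] .
  have finQ: "finite Q" using finite_elements[OF finite_strip assms(1)] .
  have ne: "X \<noteq> {}" "Y \<noteq> {}" using XY by auto
  have "u \<notin> Y" using assms(1) XY(3) by (auto simp: partition_on_def strip_def u_def)
  let ?conn = "\<forall>D\<in>Q. edge_connected D"
  let ?g = "\<lambda>B C. g (card Q + of_bool (B = {}) + of_bool (C = {}))"
  have "?lhs = (\<Sum>B\<in>insert {} Q. \<Sum>C\<in>insert {} (add_to_block u B Q).
    if ?conn \<and> B \<in> {{}, X} \<and> C \<in> {{}, Y} then ?g B C else 0)"
  proof (intro sum.cong refl)
    fix B C assume B: "B \<in> insert {} Q" and C: "C \<in> insert {} (add_to_block u B Q)"
    note e = assms(1) XY B C meta_eq_to_obj_eq[OF u_def] meta_eq_to_obj_eq[OF v_def]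
    \<comment> \<open>Thus the condition on \<open>B\<close> and \<open>C\<close> already rules out
      the linked case.\<close>
    have *: "C \<notin> {{}, Y}" if "C = insert u B"
      using that \<open>u \<notin> Y\<close> by blast
    show "(let P = add_to_block v C (add_to_block u B Q)
      in if (\<forall>D\<in>P. edge_connected D) \<and> \<not> linked (Suc n) P then g (card P) else 0) =
      (if ?conn \<and> B \<in> {{}, X} \<and> C \<in> {{}, Y} then ?g B C else 0)"
      unfolding Let_def edge_connected_add_column[OF e] linked_add_column[OF e] card_add_column[OF e]
      using * by (cases "C = insert u B") (simp_all only: simp_thms if_True if_False)
  qed
  also have "\<dots> = (\<Sum>B\<in>{{}, X}. \<Sum>C\<in>insert {} (add_to_block u B Q).
    if ?conn \<and> B \<in> {{}, X} \<and> C \<in> {{}, Y} then ?g B C else 0)"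
    using finQ XY by (intro sum.mono_neutral_right) auto
  also have "\<dots> = (\<Sum>B\<in>{{}, X}. \<Sum>C\<in>(if B = Y then {{}} else {{}, Y}). if ?conn then ?g B C else 0)"
  proof (rule sum.cong[OF refl])
    fix B assume B: "B \<in> {{}, X}"
    have fin: "finite (insert {} (add_to_block u B Q))" using finQ by (simp add: add_to_block_def)
    \<comment> \<open>Once \<open>u\<close> has joined \<open>Y\<close>, that block has been
      replaced by \<open>insert u Y\<close> and is no longer available for \<open>v\<close>.\<close>
    have mem: "Y \<in> add_to_block u B Q \<longleftrightarrow> B \<noteq> Y"
      using XY(3) \<open>u \<notin> Y\<close> unfolding add_to_block_def by blast
    show "(\<Sum>C\<in>insert {} (add_to_block u B Q).
        if ?conn \<and> B \<in> {{}, X} \<and> C \<in> {{}, Y} then ?g B C else 0) =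
      (\<Sum>C\<in>(if B = Y then {{}} else {{}, Y}). if ?conn then ?g B C else 0)"
    proof (rule sum.mono_neutral_cong_right[OF fin])
      show "(if B = Y then {{}} else {{}, Y}) \<subseteq> insert {} (add_to_block u B Q)"
        using mem by simp
      show "\<forall>C\<in>insert {} (add_to_block u B Q) - (if B = Y then {{}} else {{}, Y}).
          (if ?conn \<and> B \<in> {{}, X} \<and> C \<in> {{}, Y} then ?g B C else 0) = 0"
        using mem by (auto split: if_splits)
      show "(if ?conn \<and> B \<in> {{}, X} \<and> C \<in> {{}, Y} then ?g B C else 0) =
          (if ?conn then ?g B C else 0)" if "C \<in> (if B = Y then {{}} else {{}, Y})" for C
        using that B by (auto split: if_splits)
    qed
  qed
  also have "\<dots> = ?rhs"
    using ne by (cases ?conn; cases "X = Y")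
      (simp_all only: lnk if_True if_False sum.neutral_const,
        simp_all add: ne[symmetric] numeral_2_eq_2)
  finally show ?thesis .
qed

lemma sum_divisions_split:
  "(\<Sum>Q | partition_on (strip (Suc n)) Q. if \<forall>D\<in>Q. edge_connected D then f Q else (0::real)) =
    (\<Sum>Q | Q \<in> divisions (Suc n) \<and> linked n Q. f Q) +
    (\<Sum>Q | Q \<in> divisions (Suc n) \<and> \<not> linked n Q. f Q)"
proof -
  have "(\<Sum>Q | partition_on (strip (Suc n)) Q. if \<forall>D\<in>Q. edge_connected D then f Q else 0) =
    (\<Sum>Q\<in>divisions (Suc n). f Q)"
    using finitely_many_partition_on[OF finite_strip[of "Suc n"]]
    by (subst sum.inter_filter[symmetric]) (auto simp: divisions_def intro!: sum.cong)
  also have "\<dots> = (\<Sum>Q | Q \<in> divisions (Suc n) \<and> linked n Q. f Q) +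
    (\<Sum>Q | Q \<in> divisions (Suc n) \<and> \<not> linked n Q. f Q)"
    by (subst sum.union_disjoint[symmetric]) (auto intro!: sum.cong)
  finally show ?thesis .
qed

lemma linked_sum_Suc:
  "linked_sum g (Suc n) =
    linked_sum (\<lambda>c. g (c + 1) + g c) n + unlinked_sum (\<lambda>c. g (c + 1) + 2 * g c) n"
proof -
  have "linked_sum g (Suc n) =
    (\<Sum>Q | partition_on (strip (Suc n)) Q. if \<forall>D\<in>Q. edge_connected D
      then g (card Q + 1) + (if linked n Q then 1 else 2) * g (card Q) else 0)"
    unfolding linked_sum_def sum_divisions_Suc[where n = "Suc n" and R = "linked (Suc n)"]
    by (intro sum.cong refl linked_extensions) simp
  then show ?thesis
    unfolding sum_divisions_split linked_sum_def unlinked_sum_def by simp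
qed

lemma unlinked_sum_Suc:
  "unlinked_sum g (Suc n) =
    linked_sum (\<lambda>c. g (c + 2) + 2 * g (c + 1)) n +
    unlinked_sum (\<lambda>c. g (c + 2) + 2 * g (c + 1) + g c) n"
proof -
  have "unlinked_sum g (Suc n) =
    (\<Sum>Q | partition_on (strip (Suc n)) Q. if \<forall>D\<in>Q. edge_connected D
      then g (card Q + 2) + 2 * g (card Q + 1) + (if linked n Q then 0 else g (card Q)) else 0)"
    unfolding unlinked_sum_def sum_divisions_Suc[where n = "Suc n" and R = "\<lambda>P. \<not> linked (Suc n) P"]
    by (intro sum.cong refl unlinked_extensions) simp
  then show ?thesis
    unfolding sum_divisions_split linked_sum_def unlinked_sum_def by simp
qed

text \<open>The base case is a single column, as the empty strip has no last column: its two squares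
  form one piece or two.\<close>

lemma linked_sum_0: "linked_sum g 0 = g 1"
  and unlinked_sum_0: "unlinked_sum g 0 = g 2"
proof -
  have "strip 0 = {}" by (simp add: strip_def)
  have "{Q. partition_on {} Q} = {{}}" by (auto simp: partition_on_empty)
  have "edge_connected {(1, 0), (0, 0)}"
    using edge_connected_insert[OF edge_connected_singleton _ share_edge_intros(1)[of 0]] by simp
  then show "linked_sum g 0 = g 1" "unlinked_sum g 0 = g 2"
    unfolding linked_sum_def unlinked_sum_def sum_divisions_Suc[where n = 0 and R = "linked 0"]
      sum_divisions_Suc[where n = 0 and R = "\<lambda>P. \<not> linked 0 P"] \<open>strip 0 = {}\<close>
      \<open>{Q. partition_on {} Q} = {{}}\<close>
    by (simp_all add: add_to_block_def linked_def Let_def numeral_2_eq_2)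
qed

section \<open>Numbers of divisions and total numbers of pieces\<close>

lemma sum_card_divisions:
  fixes f :: "nat \<Rightarrow> real"
  shows "(\<Sum>k\<le>2 * n. f k * real (r k n)) = (\<Sum>P\<in>divisions n. f (card P))"
proof -
  have bound: "card P \<le> 2 * n" if "P \<in> divisions n" for P
  proof (rule ccontr)
    assume "\<not> card P \<le> 2 * n"
    then have "card {P' \<in> divisions n. card P' = card P} = 0"
      using r_eq_0[of n "card P"] by (simp add: r_def)
    then have "{P' \<in> divisions n. card P' = card P} = {}" by simp
    with that show False by blast
  qed
  have "(\<Sum>P\<in>divisions n. f (card P)) =
    (\<Sum>k\<le>2 * n. \<Sum>P | P \<in> divisions n \<and> card P = k. f (card P))"
    using bound by (intro sum.group[symmetric]) auto
  also have "\<dots> = (\<Sum>k\<le>2 * n. f k * real (r k n))"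
    by (intro sum.cong refl) (simp add: r_def mult.commute)
  finally show ?thesis by simp
qed

lemma sum_divisions_linked:
  "(\<Sum>P\<in>divisions (Suc n). f (card P)) = linked_sum f n + unlinked_sum f n"
  unfolding linked_sum_def unlinked_sum_def
  by (subst sum.union_disjoint[symmetric]) (auto intro!: sum.cong)

abbreviation "linked_count \<equiv> linked_sum (\<lambda>_. 1)"
abbreviation "unlinked_count \<equiv> unlinked_sum (\<lambda>_. 1)"

lemma linked_sum_add: "linked_sum (\<lambda>c. f c + g c) n = linked_sum f n + linked_sum g n"
  and unlinked_sum_add: "unlinked_sum (\<lambda>c. f c + g c) n = unlinked_sum f n + unlinked_sum g n"
  and linked_sum_cmult: "linked_sum (\<lambda>c. a * g c) n = a * linked_sum g n"
  and unlinked_sum_cmult: "unlinked_sum (\<lambda>c. a * g c) n = a * unlinked_sum g n"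
  by (simp_all add: linked_sum_def unlinked_sum_def sum.distrib sum_distrib_left)

lemma linked_sum_const: "linked_sum (\<lambda>_. a) n = a * linked_count n"
  and unlinked_sum_const: "unlinked_sum (\<lambda>_. a) n = a * unlinked_count n"
  by (simp_all add: linked_sum_def unlinked_sum_def)

text \<open>The coefficients count extensions: \<open>1 + 1\<close> and \<open>1 + 2\<close> linked
  ones, \<open>1 + 2\<close> and \<open>1 + 2 + 1\<close> unlinked ones.\<close>

lemma linked_count_Suc: "linked_count (Suc n) = 2 * linked_count n + 3 * unlinked_count n"
  and unlinked_count_Suc: "unlinked_count (Suc n) = 3 * linked_count n + 4 * unlinked_count n"
  by (simp_all add: linked_sum_Suc[of "\<lambda>_. 1"] unlinked_sum_Suc[of "\<lambda>_. 1"]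
      linked_sum_const[of 2] linked_sum_const[of 3] unlinked_sum_const[of 3] unlinked_sum_const[of 4])

text \<open>The forcing terms count the pieces opened in the new column: 1 over all linked
  extensions of a division, \<open>2 + 1 + 1\<close> over all unlinked ones.\<close>

lemma linked_sum_card_Suc:
    "linked_sum real (Suc n) =
      2 * linked_sum real n + 3 * unlinked_sum real n + linked_count n + unlinked_count n"
  and unlinked_sum_card_Suc:
    "unlinked_sum real (Suc n) =
      3 * linked_sum real n + 4 * unlinked_sum real n + 4 * linked_count n + 4 * unlinked_count n"
proof -
  have *: "(\<lambda>c. real (c + 1) + real c) = (\<lambda>c. 2 * real c + 1)"
    "(\<lambda>c. real (c + 1) + 2 * real c) = (\<lambda>c. 3 * real c + 1)"
    "(\<lambda>c. real (c + 2) + 2 * real (c + 1)) = (\<lambda>c. 3 * real c + 4)"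
    "(\<lambda>c. real (c + 2) + 2 * real (c + 1) + real c) = (\<lambda>c. 4 * real c + 4)"
    by auto
  show "linked_sum real (Suc n) =
      2 * linked_sum real n + 3 * unlinked_sum real n + linked_count n + unlinked_count n"
    unfolding linked_sum_Suc * linked_sum_add unlinked_sum_add linked_sum_cmult unlinked_sum_cmult
    by simp
  show "unlinked_sum real (Suc n) =
      3 * linked_sum real n + 4 * unlinked_sum real n + 4 * linked_count n + 4 * unlinked_count n"
    unfolding unlinked_sum_Suc * linked_sum_add unlinked_sum_add linked_sum_cmult unlinked_sum_cmult
      linked_sum_const[of 4] unlinked_sum_const[of 4]
    by simp
qed

text \<open>The coefficients come from the ansatz \<open>a' n = n K (a n) + L (a n)\<close> for the vector \<open>a'\<close> of
  weighted counts in terms of the vector \<open>a\<close> of counts: with \<open>M\<close> the matrix of the recursion of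
  \<open>a\<close>, the matrix \<open>K\<close> is a linear combination of \<open>M\<close> and the identity.\<close>

lemma linked_sum_card:
    "linked_sum real n = real n * (17/10 * linked_count n - 6/10 * unlinked_count n)
      + 13/20 * linked_count n + 7/20 * unlinked_count n"
  and unlinked_sum_card:
    "unlinked_sum real n = real n * (13/10 * unlinked_count n - 6/10 * linked_count n)
      + 11/20 * linked_count n + 29/20 * unlinked_count n"
proof (induction n)
  case 0
  case 1 show ?case by (simp add: linked_sum_0 unlinked_sum_0)
  case 2 show ?case by (simp add: linked_sum_0 unlinked_sum_0)
next
  case (Suc n)
  case 1 show ?case
    unfolding linked_sum_card_Suc linked_count_Suc unlinked_count_Suc Suc.IH
    by (simp add: field_simps)
  case 2 show ?case
    unfolding unlinked_sum_card_Suc linked_count_Suc unlinked_count_Suc Suc.IH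
    by (simp add: field_simps)
qed

lemma expected_pieces_Suc:
  "expected_pieces (Suc n) =
    (real n * (11 * linked_count n + 7 * unlinked_count n) + 12 * linked_count n + 18 * unlinked_count n)
    / (10 * (linked_count n + unlinked_count n))"
proof -
  have "expected_pieces (Suc n) =
    (linked_sum real n + unlinked_sum real n) / (linked_count n + unlinked_count n)"
    using sum_card_divisions[of real "Suc n"] sum_card_divisions[of "\<lambda>_. 1" "Suc n"]
      sum_divisions_linked[of real n] sum_divisions_linked[of "\<lambda>_. 1" n]
    unfolding expected_pieces_def by (simp del: mult_Suc_right)
  also have "linked_sum real n + unlinked_sum real n =
    (real n * (11 * linked_count n + 7 * unlinked_count n) + 12 * linked_count n + 18 * unlinked_count n) / 10"
    unfolding linked_sum_card unlinked_sum_card by (simp add: field_simps)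
  finally show ?thesis by simp
qed

section \<open>Limits and the asymptotic constant\<close>

lemma counts_ge_1: "linked_count n \<ge> 1" "unlinked_count n \<ge> 1"
proof (induction n)
  case 0
  case 1 show ?case by (simp add: linked_sum_0)
  case 2 show ?case by (simp add: unlinked_sum_0)
next
  case (Suc n)
  case 1 show ?case unfolding linked_count_Suc using Suc.IH by linarith
  case 2 show ?case unfolding unlinked_count_Suc using Suc.IH by linarith
qed

text \<open>The combination on the left is the one along the eigenvector for the eigenvalue
  \<open>3 - sqrt 10\<close>, which is smaller than 1 in absolute value.\<close>

lemma counts_eigen:
  "3 * linked_count n - (sqrt 10 - 1) * unlinked_count n = (4 - sqrt 10) * (3 - sqrt 10) ^ n"
proof (induction n)
  case 0
  show ?case by (simp add: linked_sum_0 unlinked_sum_0)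
next
  case (Suc n)
  \<comment> \<open>A variable \<open>s\<close> replaces \<open>sqrt 10\<close>; the two sides then
    differ by a multiple of \<open>s * s - 10\<close>.\<close>
  have s: "3 * (2 * a + 3 * b) - (s - 1) * (3 * a + 4 * b) = (3 - s) * (3 * a - (s - 1) * b)"
    if "s * s = 10" for s a b :: real
  proof -
    have "(3 - s) * (3 * a - (s - 1) * b) =
      3 * (2 * a + 3 * b) - (s - 1) * (3 * a + 4 * b) + (s * s - 10) * b"
      by (simp add: algebra_simps)
    with that show ?thesis by simp
  qed
  have "3 * linked_count (Suc n) - (sqrt 10 - 1) * unlinked_count (Suc n) =
    (3 - sqrt 10) * (3 * linked_count n - (sqrt 10 - 1) * unlinked_count n)"
    unfolding linked_count_Suc unlinked_count_Suc by (rule s) simp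
  then show ?case using Suc.IH by simp
qed

text \<open>Divide \<open>counts_eigen\<close> by \<open>unlinked_count n\<close>: the right-hand
  side vanishes in the limit because \<open>3 - sqrt 10\<close> lies strictly between -1 and
  0.\<close>

lemma count_ratio_tendsto:
  "(\<lambda>n. linked_count n / unlinked_count n) \<longlonglongrightarrow> (sqrt 10 - 1) / 3"
proof -
  have s: "3 < sqrt 10" "sqrt 10 < 4"
    by (auto intro: real_less_rsqrt real_less_lsqrt)
  have "(\<lambda>n. 3 * linked_count n / unlinked_count n - (sqrt 10 - 1)) \<longlonglongrightarrow> 0"
  proof (rule Lim_null_comparison)
    show "(\<lambda>n. \<bar>4 - sqrt 10\<bar> * \<bar>3 - sqrt 10\<bar> ^ n) \<longlonglongrightarrow> 0"
      using s by (intro tendsto_mult_right_zero LIMSEQ_power_zero) auto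
    show "\<forall>\<^sub>F n in sequentially. norm (3 * linked_count n / unlinked_count n - (sqrt 10 - 1))
      \<le> \<bar>4 - sqrt 10\<bar> * \<bar>3 - sqrt 10\<bar> ^ n"
    proof (intro always_eventually allI)
      fix n
      have u: "unlinked_count n \<ge> 1" by (rule counts_ge_1)
      then have "3 * linked_count n / unlinked_count n - (sqrt 10 - 1) =
        (4 - sqrt 10) * (3 - sqrt 10) ^ n / unlinked_count n"
        using counts_eigen[of n] by (simp add: field_simps)
      also have "norm \<dots> = \<bar>4 - sqrt 10\<bar> * \<bar>3 - sqrt 10\<bar> ^ n / unlinked_count n"
        using u by (simp add: abs_mult power_abs)
      \<comment> \<open>Dividing by a number that is at least 1 does not enlarge the error, so no
        growth rate of the counts is required.\<close>
      also have "\<dots> \<le> \<bar>4 - sqrt 10\<bar> * \<bar>3 - sqrt 10\<bar> ^ n / 1"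
        using u by (intro divide_left_mono) auto
      finally show "norm (3 * linked_count n / unlinked_count n - (sqrt 10 - 1))
        \<le> \<bar>4 - sqrt 10\<bar> * \<bar>3 - sqrt 10\<bar> ^ n" by simp
    qed
  qed
  then have "(\<lambda>n. (3 * linked_count n / unlinked_count n - (sqrt 10 - 1) + (sqrt 10 - 1)) / 3)
    \<longlonglongrightarrow> (0 + (sqrt 10 - 1)) / 3"
    by (intro tendsto_intros) auto
  then show ?thesis by simp
qed

lemma sqrt_2_5: "sqrt (2 / 5) = sqrt 10 / (5::real)"
proof -
  have "sqrt (2 / 5) = sqrt (10 / 25)" by simp
  also have "\<dots> = sqrt 10 / sqrt 25" by (rule real_sqrt_divide)
  also have "sqrt 25 = (5::real)" by (simp add: real_sqrt_unique)
  finally show ?thesis .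
qed

text \<open>By homogeneity the quotient depends on the counts only through their ratio
  \<open>t\<close>; the part without the factor \<open>real n\<close> is bounded and disappears
  after division by \<open>Suc n\<close>.\<close>

lemma expected_pieces_tendsto:
  "(\<lambda>n. expected_pieces (Suc n) / real (Suc n)) \<longlonglongrightarrow> 3 / 2 - sqrt (2 / 5)"
proof -
  define t where "t n = linked_count n / unlinked_count n" for n
  define b where "b = (sqrt 10 - 1) / (3::real)"
  have t: "t \<longlonglongrightarrow> b"
    using count_ratio_tendsto unfolding t_def b_def .
  have s: "sqrt 10 * sqrt 10 = (10::real)" by simp
  have "sqrt 10 > (3::real)" by (auto intro: real_less_rsqrt)
  then have "b > 0" by (simp add: b_def)
  have "expected_pieces (Suc n) / real (Suc n) =
    (real n / real (Suc n)) * ((11 * t n + 7) / (10 * (t n + 1))) +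
    (1 / real (Suc n)) * ((12 * t n + 18) / (10 * (t n + 1)))" for n
  proof -
    have pos: "unlinked_count n > 0" "linked_count n > 0"
      using counts_ge_1[of n] by linarith+
    then have L: "linked_count n = unlinked_count n * t n" by (simp add: t_def)
    have "expected_pieces (Suc n) =
      (unlinked_count n * (real n * (11 * t n + 7) + (12 * t n + 18))) /
      (unlinked_count n * (10 * (t n + 1)))"
      unfolding expected_pieces_Suc L by (simp add: algebra_simps)
    then have "expected_pieces (Suc n) =
      (real n * (11 * t n + 7) + (12 * t n + 18)) / (10 * (t n + 1))"
      using pos by simp
    moreover have "(m * a + c) / d / k = (m / k) * (a / d) + (1 / k) * (c / d)" for m a c d k :: real
      by (simp add: add_divide_distrib mult.commute)
    ultimately show ?thesis by (simp only:)
  qed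
  moreover have "(\<lambda>n. (real n / real (Suc n)) * ((11 * t n + 7) / (10 * (t n + 1))) +
    (1 / real (Suc n)) * ((12 * t n + 18) / (10 * (t n + 1)))) \<longlonglongrightarrow>
    1 * ((11 * b + 7) / (10 * (b + 1))) + 0 * ((12 * b + 18) / (10 * (b + 1)))"
    using \<open>b > 0\<close> LIMSEQ_n_over_Suc_n[where 'a = real] LIMSEQ_inverse_real_of_nat
    by (intro tendsto_intros t) (auto simp: inverse_eq_divide)
  moreover have "(11 * b + 7) / (10 * (b + 1)) = 3 / 2 - sqrt (2 / 5)"
  proof -
    \<comment> \<open>Both sides equal \<open>(11 * sqrt 10 + 10) / 3\<close>, using
      \<open>sqrt 10 * sqrt 10 = 10\<close>.\<close>
    have "11 * b + 7 = (3 / 2 - sqrt 10 / 5) * (10 * (b + 1))"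
      unfolding b_def using s by (simp add: field_simps)
    then show ?thesis
      using \<open>b > 0\<close> unfolding sqrt_2_5 by (simp add: field_simps)
  qed
  ultimately show ?thesis by simp
qed

theorem theorem5:
  shows "expected_pieces \<sim>[at_top] (\<lambda>n. (3 / 2 - sqrt (2 / 5)) * real n)
    \<and> \<bar>(3 / 2 - sqrt (2 / 5)) - 0.867544\<bar> < (5 / 10 ^ 7 :: real)"
proof
  let ?c = "3 / 2 - sqrt (2 / 5) :: real"
  \<comment> \<open>The tolerance is half a unit of the sixth decimal. It amounts to
    \<open>sqrt (2 / 5)\<close> lying strictly between 0.6324555 and 0.6324565, which
    \<open>lo\<close> and \<open>hi\<close> imply.\<close>
  have lo: "0.6324555 < sqrt (2 / 5 :: real)"
    by (rule real_less_rsqrt) (simp add: power2_eq_square)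
  have hi: "sqrt (2 / 5 :: real) < 0.6324564"
    by (rule real_less_lsqrt) (simp_all add: power2_eq_square)
  from lo hi show "\<bar>?c - 0.867544\<bar> < (5 / 10 ^ 7 :: real)"
    by (auto simp: abs_if)
  have "?c \<noteq> 0" using hi by simp
  \<comment> \<open>The limit was obtained along \<open>Suc n\<close>, because the recursion is
    indexed by the last column instead of the length.\<close>
  have "(\<lambda>n. expected_pieces n / real n) \<longlonglongrightarrow> ?c"
    using expected_pieces_tendsto by (rule LIMSEQ_imp_Suc)
  then have "(\<lambda>n. expected_pieces n / real n / ?c) \<longlonglongrightarrow> ?c / ?c"
    using \<open>?c \<noteq> 0\<close> by (intro tendsto_intros)
  then have "(\<lambda>n. expected_pieces n / (?c * real n)) \<longlonglongrightarrow> 1"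
    using \<open>?c \<noteq> 0\<close> by (simp add: mult.commute)
  then show "expected_pieces \<sim>[at_top] (\<lambda>n. ?c * real n)"
    by (rule asymp_equivI'_const[where c = 1, simplified])
qed

end
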